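(* Let $S\in M_{2n}(\mathbb{C})$ be symplectic with $\lambda_1,\lambda_1^{-1}\in\sigma(S)$ and let $\mu\in\mathbb{C}\setminus\{0\}$ be given. Let $x_1,x_2\in\mathbb{C}^{2n}$ be eigenvectors of $S$ for $\lambda_1$ and $\lambda_1^{-1}$, respectively, with $\|x_1\|_2=\|x_2\|_2=1$ and $x_1^TJx_2\neq 0$, and let $$X = \frac{1}{\sqrt{x_1^TJx_2}}\,[\,x_1\;\;x_2\,]\in M_{2n\times 2}(\mathbb{C}).$$ Define $\Phi := \dfrac{2}{|x_1^TJx_2|}$ (which equals $2\kappa(S,\lambda_1)$ if $\lambda_1$ is a simple eigenvalue of $S$). Let $$R_1 = \begin{bmatrix} 0 & \lambda_1^{-1}(\mu-\lambda_1)\\ \mu^{-1}(\mu-\lambda_1) & 0\end{bmatrix},\qquad R_2 = \begin{bmatrix} 0 & \mu^{-1}(\lambda_1^{-1}-\mu)\\ \lambda_1(\lambda_1^{-1}-\mu) & 0\end{bmatrix}.$$ (i) For $\hat{S}_1 = S + XR_1X^TJ^TS$, $$\frac{\|\hat{S}_1-S\|_F}{\|S\|_F}\le \frac{|\lambda_1-\mu|}{|\lambda_1|}\left[\Phi\sqrt{1+\frac{|\lambda_1|^2}{|\mu|^2}}\right].$$ (ii) For $\hat{S}_2 = S+XR_2X^TJ^TS$, $$\frac{\|\hat{S}_2-S\|_F}{\|S\|_F}\le \frac{|\lambda_1^{-1}-\mu|}{|\lambda_1^{-1}|}\left[\Phi\sqrt{1+\frac{|\lambda_1^{-1}|^2}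{|\mu|^2}}\right].$$
   Context: $M_{m\times n}(\mathbb{C})$ is the set of complex $m\times n$ matrices, $M_n(\mathbb{C})=M_{n\times n}(\mathbb{C})$, $\sigma(S)$ is the spectrum, $^T$ is the transpose without conjugation, $^H$ is the conjugate transpose, $\|\cdot\|_F$ is the Frobenius norm. $J=J_{2n} = \begin{bmatrix} 0 & I_n \\ -I_n & 0\end{bmatrix}$; $S\in M_{2n}(\mathbb{C})$ is symplectic if $S^TJS=J$. $\sqrt{x_1^TJx_2}$ is a fixed complex square root. For a simple eigenvalue $\lambda$ (algebraic multiplicity one) of a square complex matrix $A$, its condition number is $\kappa(A,\lambda) = \|u\|_2\|v\|_2/|v^Hu|$, where $u,v$ are right and left eigenvectors of $A$ for $\lambda$, i.e. $Au=\lambda u$ and $v^HA=\lambda v^H$. *)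

theory Defs
  imports "Jordan_Normal_Form.Spectral_Radius"
begin

definition J_mat :: "nat \<Rightarrow> complex mat" where
  "J_mat n = four_block_mat (0\<^sub>m n n) (1\<^sub>m n) (- 1\<^sub>m n) (0\<^sub>m n n)"

definition symplectic_mat :: "nat \<Rightarrow> complex mat \<Rightarrow> bool" where
  "symplectic_mat n S \<longleftrightarrow>
     S \<in> carrier_mat (2 * n) (2 * n) \<and> transpose_mat S * J_mat n * S = J_mat n"

definition vec_norm2 :: "complex vec \<Rightarrow> real" where
  "vec_norm2 v = sqrt (\<Sum>i<dim_vec v. (cmod (v $ i))\<^sup>2)"

definition frob_norm :: "complex mat \<Rightarrow> real" where
  "frob_norm A = sqrt (\<Sum>i<dim_row A. \<Sum>j<dim_col A. (cmod (A $$ (i, j)))\<^sup>2)"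

definition simple_eigenvalue :: "complex mat \<Rightarrow> complex \<Rightarrow> bool" where
  "simple_eigenvalue A l \<longleftrightarrow> Polynomial.order l (char_poly A) = 1"

text \<open>The row vector \<open>v\<^sup>H\<close> is rendered as \<open>mat_of_row (conjugate v)\<close>.\<close>

definition left_eigenvector :: "complex mat \<Rightarrow> complex vec \<Rightarrow> complex \<Rightarrow> bool" where
  "left_eigenvector A v l \<longleftrightarrow> v \<in> carrier_vec (dim_row A) \<and> v \<noteq> 0\<^sub>v (dim_row A) \<and>
     mat_of_row (conjugate v) * A = l \<cdot>\<^sub>m mat_of_row (conjugate v)"

text \<open>The quotient does not depend on the choice of \<open>u\<close> and \<open>v\<close> when \<open>l\<close> is a simple
  eigenvalue of the square matrix \<open>A\<close>; only then is the value below meaningful.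
  The product \<open>\<bullet>\<close> is bilinear, so \<open>conjugate v \<bullet> u\<close> is \<open>v\<^sup>H u\<close>.\<close>

definition eigenvalue_cond :: "complex mat \<Rightarrow> complex \<Rightarrow> real" where
  "eigenvalue_cond A l = (THE k. \<exists>u v. eigenvector A u l \<and> left_eigenvector A v l \<and>
     k = vec_norm2 u * vec_norm2 v / cmod (conjugate v \<bullet> u))"

end

theory Submission
  imports Defs "HOL-Analysis.L2_Norm"
begin

text \<open>
  The perturbation \<open>X R X\<^sup>T J\<^sup>T S\<close> is a product, and the Frobenius norm is
  submultiplicative (\<open>frob_norm_mult_le\<close>), so its norm is at most
  \<open>\<parallel>X\<parallel>\<^sup>2 \<parallel>R\<parallel> \<parallel>J\<^sup>T S\<parallel>\<close>. Since \<open>J\<close> only permutes coordinates and changes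
  signs, \<open>\<parallel>J\<^sup>T S\<parallel> = \<parallel>S\<parallel>\<close>. The columns of \<open>X\<close> are unit vectors divided by a square
  root of \<open>c = x\<^sub>1\<^sup>T J x\<^sub>2\<close>, so \<open>\<parallel>X\<parallel>\<^sup>2 = 2 / \<bar>c\<bar> = \<Phi>\<close>. The relative change is
  therefore at most \<open>\<Phi> \<parallel>R\<parallel>\<close>, and for the two given matrices \<open>R\<close> the norm is the
  remaining factor of the bound.

  The link between \<open>\<Phi>\<close> and the condition number comes from the left eigenvector that the
  symplectic structure supplies: \<open>S\<^sup>T J S = J\<close> turns \<open>S x\<^sub>2 = \<lambda>\<^sub>1\<^sup>-\<^sup>1 x\<^sub>2\<close> into
  \<open>S\<^sup>T (J x\<^sub>2) = \<lambda>\<^sub>1 (J x\<^sub>2)\<close>. So the conjugate of \<open>J x\<^sub>2\<close> is a unit left eigenvector for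
  \<open>\<lambda>\<^sub>1\<close>, and with the right eigenvector \<open>x\<^sub>1\<close> the quotient defining the condition number
  is \<open>1 / \<bar>c\<bar>\<close>. That this quotient is the condition number requires that it does not depend on
  the eigenvectors; this holds because the eigenspaces of \<open>S\<close> and \<open>S\<^sup>T\<close> for a simple
  eigenvalue are lines (\<open>simple_eigenvalue_eigenspace_line\<close>, which rests on Schur
  triangularisation).
\<close>

section \<open>Euclidean and Frobenius norms\<close>

lemma vec_norm2_nonneg: "0 \<le> vec_norm2 v"
  by (simp add: vec_norm2_def sum_nonneg)

lemma vec_norm2_square: "(vec_norm2 v)\<^sup>2 = (\<Sum>i<dim_vec v. (cmod (v $ i))\<^sup>2)"
  by (simp add: vec_norm2_def sum_nonneg)

lemma vec_norm2_eq_0_iff: "vec_norm2 v = 0 \<longleftrightarrow> v = 0\<^sub>v (dim_vec v)"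
proof -
  have "vec_norm2 v = 0 \<longleftrightarrow> (\<forall>i<dim_vec v. v $ i = 0)"
    by (auto simp: vec_norm2_def sum_nonneg_eq_0_iff)
  then show ?thesis
    by (metis eq_vecI index_zero_vec(1) index_zero_vec(2))
qed

lemma vec_norm2_smult: "vec_norm2 (a \<cdot>\<^sub>v v) = cmod a * vec_norm2 v"
  by (simp add: vec_norm2_def norm_mult power_mult_distrib sum_distrib_left[symmetric]
      real_sqrt_mult)

lemma vec_norm2_uminus: "vec_norm2 (- v) = vec_norm2 v"
  by (simp add: vec_norm2_def)

lemma vec_norm2_conjugate: "vec_norm2 (conjugate v) = vec_norm2 v"
  by (simp add: vec_norm2_def)

lemma vec_norm2_append_square:
  "(vec_norm2 (u @\<^sub>v v))\<^sup>2 = (vec_norm2 u)\<^sup>2 + (vec_norm2 v)\<^sup>2"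
proof -
  have split: "(\<Sum>i<p + q. f i) = (\<Sum>i<p. f i) + (\<Sum>i<q. f (i + p))"
    for f :: "nat \<Rightarrow> real" and p q
    by (induction q) (simp_all add: add.commute add.left_commute)
  show ?thesis
    by (simp add: vec_norm2_square split)
qed

lemma cmod_scalar_prod_le:
  assumes "dim_vec u = dim_vec v"
  shows "cmod (u \<bullet> v) \<le> vec_norm2 u * vec_norm2 v"
proof -
  have "cmod (u \<bullet> v) \<le> (\<Sum>i<dim_vec v. cmod (u $ i) * cmod (v $ i))"
    unfolding scalar_prod_def atLeast0LessThan
    by (rule order_trans[OF norm_sum]) (simp add: norm_mult)
  also have "\<dots> \<le> vec_norm2 u * vec_norm2 v"
    using L2_set_mult_ineq[of "\<lambda>i. cmod (u $ i)" "\<lambda>i. cmod (v $ i)" "{..<dim_vec v}"]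
    by (simp add: vec_norm2_def L2_set_def assms)
  finally show ?thesis .
qed

lemma frob_norm_nonneg: "0 \<le> frob_norm A"
  by (simp add: frob_norm_def sum_nonneg)

lemma frob_norm_square_rows: "(frob_norm A)\<^sup>2 = (\<Sum>i<dim_row A. (vec_norm2 (row A i))\<^sup>2)"
  by (simp add: frob_norm_def vec_norm2_square sum_nonneg)

lemma frob_norm_square_cols: "(frob_norm A)\<^sup>2 = (\<Sum>j<dim_col A. (vec_norm2 (col A j))\<^sup>2)"
  unfolding frob_norm_def
  by (subst sum.swap) (simp add: vec_norm2_square sum_nonneg)

lemma frob_norm_transpose: "frob_norm (transpose_mat A) = frob_norm A"
  unfolding frob_norm_def by (subst sum.swap) simp

text \<open>Cauchy--Schwarz bounds each entry of \<open>A * B\<close> by the product of the norms of a row of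
  \<open>A\<close> and a column of \<open>B\<close>; the sum of the squares of these bounds factors.\<close>

lemma frob_norm_mult_le:
  assumes "dim_col A = dim_row B"
  shows "frob_norm (A * B) \<le> frob_norm A * frob_norm B"
proof (rule power2_le_imp_le)
  have "(frob_norm (A * B))\<^sup>2
      = (\<Sum>i<dim_row A. \<Sum>j<dim_col B. (cmod (row A i \<bullet> col B j))\<^sup>2)"
    by (simp add: frob_norm_def sum_nonneg)
  also have "\<dots> \<le> (\<Sum>i<dim_row A. \<Sum>j<dim_col B. (vec_norm2 (row A i) * vec_norm2 (col B j))\<^sup>2)"
    by (intro sum_mono power_mono cmod_scalar_prod_le) (simp_all add: assms)
  also have "\<dots> = (frob_norm A * frob_norm B)\<^sup>2"
    by (simp add: power_mult_distrib frob_norm_square_rows[of A] frob_norm_square_cols[of B]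
        sum_product)
  finally show "(frob_norm (A * B))\<^sup>2 \<le> (frob_norm A * frob_norm B)\<^sup>2" .
  show "0 \<le> frob_norm A * frob_norm B"
    by (simp add: frob_norm_nonneg)
qed

lemma frob_norm_two_cols_square:
  assumes "x \<in> carrier_vec m" and "y \<in> carrier_vec m"
  shows "(frob_norm (a \<cdot>\<^sub>m mat_of_cols m [x, y]))\<^sup>2
    = (cmod a)\<^sup>2 * ((vec_norm2 x)\<^sup>2 + (vec_norm2 y)\<^sup>2)"
proof -
  have "{..<Suc (Suc 0)} = {0, 1}" by auto
  then show ?thesis
    using assms
    by (simp add: frob_norm_square_cols vec_norm2_smult power_mult_distrib distrib_left)
qed

lemma frob_norm_antidiagonal:
  "frob_norm (mat_of_rows_list 2 [[0, a], [b, 0]]) = sqrt ((cmod a)\<^sup>2 + (cmod b)\<^sup>2)"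
proof -
  have "{..<2::nat} = {0, 1}" "{..<Suc (Suc 0)} = {0, 1}" by auto
  then show ?thesis
    by (simp add: frob_norm_def mat_of_rows_list_def)
qed

section \<open>The symplectic form\<close>

lemma J_mat_carrier: "J_mat n \<in> carrier_mat (2 * n) (2 * n)"
  using four_block_carrier_mat[of "0\<^sub>m n n" n n "0\<^sub>m n n" n n "1\<^sub>m n" "- 1\<^sub>m n"]
  by (simp add: J_mat_def mult_2)

lemma transpose_J_mat: "transpose_mat (J_mat n) = - J_mat n"
  by (rule eq_matI) (auto simp: J_mat_def)

lemma J_mat_mult_append:
  assumes u: "u \<in> carrier_vec n" and w: "w \<in> carrier_vec n"
  shows "J_mat n *\<^sub>v (u @\<^sub>v w) = w @\<^sub>v - u"
  unfolding J_mat_def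
  by (subst four_block_mat_mult_vec[of _ n n _ n _ n]) (use u w in auto)

lemma vec_norm2_J_mat_mult:
  assumes v: "v \<in> carrier_vec (2 * n)"
  shows "vec_norm2 (J_mat n *\<^sub>v v) = vec_norm2 v"
proof -
  have v': "v \<in> carrier_vec (n + n)"
    using v by (simp add: mult_2)
  define u w where "u = vec_first v n" and "w = vec_last v n"
  have u: "u \<in> carrier_vec n" and w: "w \<in> carrier_vec n" and split: "v = u @\<^sub>v w"
    using v' by (simp_all add: u_def w_def)
  have "(vec_norm2 (J_mat n *\<^sub>v v))\<^sup>2 = (vec_norm2 v)\<^sup>2"
    unfolding split J_mat_mult_append[OF u w] vec_norm2_append_square vec_norm2_uminus
    by simp
  then show ?thesis
    by (simp add: vec_norm2_nonneg)
qed

lemma frob_norm_transpose_J_mat_mult: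
  assumes A: "A \<in> carrier_mat (2 * n) m"
  shows "frob_norm (transpose_mat (J_mat n) * A) = frob_norm A"
proof -
  have "vec_norm2 (col (transpose_mat (J_mat n) * A) j) = vec_norm2 (col A j)" if "j < m" for j
  proof -
    have c: "col A j \<in> carrier_vec (2 * n)"
      using A that by auto
    have "col (transpose_mat (J_mat n) * A) j = - (J_mat n *\<^sub>v col A j)"
      unfolding transpose_J_mat
      using col_mult2[OF _ A that, of "- J_mat n" "2 * n"] J_mat_carrier[of n] A
      by (simp add: uminus_mult_mat_vec carrier_matD[OF J_mat_carrier])
    then show ?thesis
      by (simp add: vec_norm2_uminus vec_norm2_J_mat_mult[OF c])
  qed
  then have "(frob_norm (transpose_mat (J_mat n) * A))\<^sup>2 = (frob_norm A)\<^sup>2"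
    using A by (simp add: frob_norm_square_cols)
  then show ?thesis
    by (simp add: frob_norm_nonneg)
qed

text \<open>An eigenvector of \<open>S\<close> for \<open>1 / l\<close> yields one of \<open>S\<^sup>T\<close> for \<open>l\<close>: a
  symplectic \<open>S\<close> satisfies \<open>S\<^sup>T J = J S\<^sup>-\<^sup>1\<close>, so \<open>J\<close> carries eigenvectors of
  \<open>S\<^sup>-\<^sup>1\<close> to eigenvectors of \<open>S\<^sup>T\<close>.\<close>

lemma symplectic_transpose_eigenvector:
  assumes S: "symplectic_mat n S" and l: "l \<noteq> 0" and x: "eigenvector S x (inverse l)"
  shows "transpose_mat S *\<^sub>v (J_mat n *\<^sub>v x) = l \<cdot>\<^sub>v (J_mat n *\<^sub>v x)"
proof -
  have C: "S \<in> carrier_mat (2 * n) (2 * n)" and J: "transpose_mat S * J_mat n * S = J_mat n"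
    using S by (auto simp: symplectic_mat_def)
  have xc: "x \<in> carrier_vec (2 * n)" and Sx: "S *\<^sub>v x = inverse l \<cdot>\<^sub>v x"
    using x C by (auto simp: eigenvector_def)
  note Jc = J_mat_carrier[of n]
  have TC: "transpose_mat S \<in> carrier_mat (2 * n) (2 * n)"
    using C by simp
  have "J_mat n *\<^sub>v x = (transpose_mat S * J_mat n * S) *\<^sub>v x"
    by (simp only: J)
  also have "\<dots> = (transpose_mat S * J_mat n) *\<^sub>v (S *\<^sub>v x)"
    by (rule assoc_mult_mat_vec[OF mult_carrier_mat[OF TC Jc] C xc])
  also have "\<dots> = inverse l \<cdot>\<^sub>v ((transpose_mat S * J_mat n) *\<^sub>v x)"
    unfolding Sx by (rule mult_mat_vec[OF mult_carrier_mat[OF TC Jc] xc])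
  also have "(transpose_mat S * J_mat n) *\<^sub>v x = transpose_mat S *\<^sub>v (J_mat n *\<^sub>v x)"
    by (rule assoc_mult_mat_vec[OF TC Jc xc])
  finally have "l \<cdot>\<^sub>v (J_mat n *\<^sub>v x)
      = l \<cdot>\<^sub>v (inverse l \<cdot>\<^sub>v (transpose_mat S *\<^sub>v (J_mat n *\<^sub>v x)))"
    by simp
  then show ?thesis
    using l by (simp add: smult_smult_assoc)
qed

text \<open>A vector in the kernel of \<open>S\<close> lies in the kernel of \<open>S\<^sup>T J S = J\<close>, and \<open>J\<close> is an
  isometry.\<close>

lemma symplectic_eigenvalue_nonzero:
  assumes S: "symplectic_mat n S" and x: "eigenvector S x l"
  shows "l \<noteq> 0"
proof
  assume l: "l = 0"
  have C: "S \<in> carrier_mat (2 * n) (2 * n)" and J: "transpose_mat S * J_mat n * S = J_mat n"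
    using S by (auto simp: symplectic_mat_def)
  have xc: "x \<in> carrier_vec (2 * n)" and Sx: "S *\<^sub>v x = 0\<^sub>v (2 * n)"
    using x C l by (auto simp: eigenvector_def)
  have TJ: "transpose_mat S * J_mat n \<in> carrier_mat (2 * n) (2 * n)"
    using C J_mat_carrier[of n] by simp
  have "J_mat n *\<^sub>v x = (transpose_mat S * J_mat n * S) *\<^sub>v x"
    by (simp only: J)
  also have "\<dots> = (transpose_mat S * J_mat n) *\<^sub>v (S *\<^sub>v x)"
    by (rule assoc_mult_mat_vec[OF TJ C xc])
  also have "\<dots> = 0\<^sub>v (2 * n)"
    unfolding Sx by (rule eq_vecI) (use C J_mat_carrier[of n] in \<open>auto simp: scalar_prod_def\<close>)
  finally have "vec_norm2 x = 0"
    using vec_norm2_J_mat_mult[OF xc] vec_norm2_eq_0_iff[of "0\<^sub>v (2 * n)"] by simp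
  then have "x = 0\<^sub>v (2 * n)"
    using xc vec_norm2_eq_0_iff[of x] by simp
  then show False
    using x C by (auto simp: eigenvector_def)
qed

section \<open>Condition numbers of simple eigenvalues\<close>

text \<open>A vector that is fixed up to the factor \<open>l\<close> by an upper triangular matrix whose diagonal
  carries \<open>l\<close> only in its first entry lies on the first coordinate axis, by back substitution:
  its last nonzero entry sits in a row whose diagonal entry must be \<open>l\<close>.\<close>

lemma upper_triangular_eigenvector_first_axis:
  fixes B :: "'a :: field mat"
  assumes B: "B \<in> carrier_mat n n" and ut: "upper_triangular B"
    and diag: "\<And>i. 0 < i \<Longrightarrow> i < n \<Longrightarrow> B $$ (i, i) \<noteq> l"
    and y: "y \<in> carrier_vec n" and ev: "B *\<^sub>v y = l \<cdot>\<^sub>v y"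
    and i: "0 < i" "i < n"
  shows "y $ i = 0"
proof (rule ccontr)
  assume yi: "y $ i \<noteq> 0"
  let ?I = "{k. 0 < k \<and> k < n \<and> y $ k \<noteq> 0}"
  define m where "m = Max ?I"
  have fin: "finite ?I" by simp
  have "m \<in> ?I"
    unfolding m_def by (rule Max_in[OF fin]) (use yi i in auto)
  then have m: "0 < m" "m < n" and ym: "y $ m \<noteq> 0" by auto
  have after: "y $ k = 0" if "m < k" "k < n" for k
  proof (rule ccontr)
    assume "y $ k \<noteq> 0"
    then have "k \<in> ?I" using that m by auto
    then have "k \<le> m" unfolding m_def by (rule Max_ge[OF fin])
    then show False using that by simp
  qed
  have "l * y $ m = (B *\<^sub>v y) $ m"
    using ev y m by simp
  also have "\<dots> = (\<Sum>k\<in>{0..<n}. B $$ (m, k) * y $ k)"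
    using B y m by (simp add: scalar_prod_def)
  also have "\<dots> = (\<Sum>k\<in>{0..<n}. if k = m then B $$ (m, m) * y $ m else 0)"
  proof (rule sum.cong[OF refl])
    fix k assume k: "k \<in> {0..<n}"
    consider "k < m" | "k = m" | "m < k" by linarith
    then show "B $$ (m, k) * y $ k = (if k = m then B $$ (m, m) * y $ m else 0)"
      using upper_triangularD[OF ut, of k m] B m k after[of k] by cases auto
  qed
  also have "\<dots> = B $$ (m, m) * y $ m"
    using m by simp
  finally show False
    using diag[OF m] ym by simp
qed

lemma simple_eigenvalue_char_poly_split:
  assumes A: "A \<in> carrier_mat n n" and simple: "simple_eigenvalue A l"
  obtains es where "char_poly A = (\<Prod>e\<leftarrow>l # es. [:- e, 1:])" and "l \<notin> set es"
proof -
  obtain fs where fs: "char_poly A = (\<Prod>e\<leftarrow>fs. [:- e, 1:])"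
    using char_poly_factorized[OF A] by auto
  have ord: "Polynomial.order l (char_poly A) = 1"
    using simple by (simp add: simple_eigenvalue_def)
  then have nz: "char_poly A \<noteq> 0"
    using degree_monic_char_poly[OF A] by auto
  have "poly (char_poly A) l = 0"
    using ord by (simp add: order_root)
  then have "l \<in> set fs"
    unfolding fs by (auto simp: poly_prod_list prod_list_zero_iff)
  then obtain ys zs where split: "fs = ys @ l # zs"
    by (auto dest: split_list)
  have cp: "char_poly A = (\<Prod>e\<leftarrow>l # (ys @ zs). [:- e, 1:])"
    unfolding fs split by (simp only: map_append list.map prod_list.append prod_list.Cons mult.left_commute)
  have "l \<notin> set (ys @ zs)"
  proof
    assume "l \<in> set (ys @ zs)"
    then have "[:- l, 1:] \<in> set (map (\<lambda>e. [:- e, 1:]) (ys @ zs))" by auto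
    then have "[:- l, 1:] dvd (\<Prod>e\<leftarrow>ys @ zs. [:- e, 1:])"
      by (rule prod_list_dvd)
    then have "[:- l, 1:] * [:- l, 1:] dvd char_poly A"
      unfolding cp list.map prod_list.Cons by (rule mult_dvd_mono[OF dvd_refl])
    then have "[:- l, 1:] ^ 2 dvd char_poly A"
      by (simp only: power2_eq_square)
    then show False
      using order_max[of l 2 "char_poly A"] nz ord by simp
  qed
  then show thesis
    using that cp by blast
qed

text \<open>In a Schur triangularisation that lists the simple eigenvalue first, the eigenvectors of the
  triangular factor lie on the first coordinate axis; so those of \<open>A\<close> are multiples of one column
  of the similarity transformation.\<close>

lemma simple_eigenvalue_eigenspace_line:
  assumes A: "A \<in> carrier_mat n n" and simple: "simple_eigenvalue A l"
  obtains p where "p \<in> carrier_vec n"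
    and "\<And>u. eigenvector A u l \<Longrightarrow> \<exists>a. a \<noteq> 0 \<and> u = a \<cdot>\<^sub>v p"
proof -
  obtain es where cp: "char_poly A = (\<Prod>e\<leftarrow>l # es. [:- e, 1:])" and l: "l \<notin> set es"
    using simple_eigenvalue_char_poly_split[OF A simple] .
  obtain B P Q where dec: "schur_decomposition A (l # es) = (B, P, Q)"
    by (cases "schur_decomposition A (l # es)")
  have sim: "similar_mat_wit A B P Q" and ut: "upper_triangular B" and dB: "diag_mat B = l # es"
    using schur_decomposition[OF A cp dec] by auto
  note w = similar_mat_witD2[OF A sim]
  have B: "B \<in> carrier_mat n n" and P: "P \<in> carrier_mat n n" and Q: "Q \<in> carrier_mat n n"
    and PQ: "P * Q = 1\<^sub>m n" and QP: "Q * P = 1\<^sub>m n" and APBQ: "A = P * B * Q"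
    using w by auto
  have len: "length es + 1 = n"
    using arg_cong[OF dB, of length] B by (simp add: diag_mat_def)
  have diag: "B $$ (i, i) \<noteq> l" if "0 < i" "i < n" for i
  proof -
    have "B $$ (i, i) = (l # es) ! i"
      unfolding dB[symmetric] using B that by (simp add: diag_mat_def)
    also have "\<dots> \<in> set es"
      using that len by (cases i) auto
    finally show ?thesis
      using l by auto
  qed
  show thesis
  proof (rule that)
    show "col P 0 \<in> carrier_vec n"
      using P by auto
    fix u assume "eigenvector A u l"
    then have u: "u \<in> carrier_vec n" and u0: "u \<noteq> 0\<^sub>v n" and Au: "A *\<^sub>v u = l \<cdot>\<^sub>v u"
      using A by (auto simp: eigenvector_def)
    define y where "y = Q *\<^sub>v u"
    have y: "y \<in> carrier_vec n"
      using Q u by (simp add: y_def)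
    have Py: "P *\<^sub>v y = u"
      unfolding y_def using assoc_mult_mat_vec[OF P Q u] PQ u by simp
    have "B *\<^sub>v y = (Q * P) *\<^sub>v (B *\<^sub>v y)"
      using B y by (simp add: QP)
    also have "\<dots> = Q *\<^sub>v (P *\<^sub>v (B *\<^sub>v y))"
      using B y by (intro assoc_mult_mat_vec[OF Q P]) simp
    also have "P *\<^sub>v (B *\<^sub>v y) = A *\<^sub>v u"
    proof -
      have PB: "P * B \<in> carrier_mat n n"
        using P B by simp
      show ?thesis
        unfolding APBQ assoc_mult_mat_vec[OF PB Q u] y_def[symmetric]
        by (rule assoc_mult_mat_vec[OF P B y, symmetric])
    qed
    also have "Q *\<^sub>v (A *\<^sub>v u) = l \<cdot>\<^sub>v y"
      unfolding Au y_def by (rule mult_mat_vec[OF Q u])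
    finally have By: "B *\<^sub>v y = l \<cdot>\<^sub>v y" .
    have y0: "y $ i = 0" if "0 < i" "i < n" for i
      by (rule upper_triangular_eigenvector_first_axis[OF B ut diag y By that])
    have axis: "u = (y $ 0) \<cdot>\<^sub>v col P 0"
    proof (rule eq_vecI)
      fix i assume "i < dim_vec ((y $ 0) \<cdot>\<^sub>v col P 0)"
      then have i: "i < n" using P by simp
      have "u $ i = (\<Sum>k\<in>{0..<n}. P $$ (i, k) * y $ k)"
        unfolding Py[symmetric] using P y i by (simp add: scalar_prod_def)
      also have "\<dots> = (\<Sum>k\<in>{0..<n}. if k = 0 then P $$ (i, 0) * y $ 0 else 0)"
        by (rule sum.cong) (use y0 in auto)
      also have "\<dots> = ((y $ 0) \<cdot>\<^sub>v col P 0) $ i"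
        using i P by simp
      finally show "u $ i = ((y $ 0) \<cdot>\<^sub>v col P 0) $ i" .
    qed (use u P in simp)
    moreover have "y $ 0 \<noteq> 0"
    proof
      assume "y $ 0 = 0"
      then have "u = 0\<^sub>v n"
        using axis P by (auto intro: eq_vecI)
      then show False
        using u0 by simp
    qed
    ultimately show "\<exists>a. a \<noteq> 0 \<and> u = a \<cdot>\<^sub>v col P 0"
      by blast
  qed
qed

text \<open>Left eigenvectors are conjugates of eigenvectors of the transpose, so facts about right
  eigenvectors apply to them as well.\<close>

lemma left_eigenvector_iff:
  assumes A: "A \<in> carrier_mat n n"
  shows "left_eigenvector A v l \<longleftrightarrow> eigenvector (transpose_mat A) (conjugate v) l"
proof -
  have "mat_of_row (conjugate v) * A = l \<cdot>\<^sub>m mat_of_row (conjugate v)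
    \<longleftrightarrow> transpose_mat A *\<^sub>v conjugate v = l \<cdot>\<^sub>v conjugate v" if v: "v \<in> carrier_vec n"
  proof -
    have "mat_of_row (conjugate v) * A = l \<cdot>\<^sub>m mat_of_row (conjugate v)
      \<longleftrightarrow> (\<forall>j<n. conjugate v \<bullet> col A j = l * conjugate v $ j)"
      using A v by (auto simp: mat_eq_iff)
    also have "\<dots> \<longleftrightarrow> (\<forall>j<n. col A j \<bullet> conjugate v = l * conjugate v $ j)"
    proof -
      have "conjugate v \<bullet> col A j = col A j \<bullet> conjugate v" for j
        by (rule comm_scalar_prod[of _ n]) (use A v in auto)
      then show ?thesis
        by simp
    qed
    also have "\<dots> \<longleftrightarrow> transpose_mat A *\<^sub>v conjugate v = l \<cdot>\<^sub>v conjugate v"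
      using A v by (auto simp: vec_eq_iff)
    finally show ?thesis .
  qed
  moreover have "conjugate v \<in> carrier_vec n \<longleftrightarrow> v \<in> carrier_vec n"
    by (metis carrier_vecD carrier_vecI dim_vec_conjugate)
  ultimately show ?thesis
    using A by (auto simp: left_eigenvector_def eigenvector_def)
qed

text \<open>Rescaling an eigenvector multiplies numerator and denominator of the quotient by the same
  factor, and for a simple eigenvalue there is no other freedom: \<open>A\<close> and its transpose have the
  same characteristic polynomial, so both the right and the left eigenvectors are determined up to
  scaling.\<close>

lemma eigenvalue_cond_eqI:
  assumes A: "A \<in> carrier_mat n n" and simple: "simple_eigenvalue A l"
    and u: "eigenvector A u l" and v: "left_eigenvector A v l"
  shows "eigenvalue_cond A l = vec_norm2 u * vec_norm2 v / cmod (conjugate v \<bullet> u)"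
proof -
  have AT: "transpose_mat A \<in> carrier_mat n n"
    using A by simp
  have simpleT: "simple_eigenvalue (transpose_mat A) l"
    using simple A by (simp add: simple_eigenvalue_def)
  obtain p where p: "p \<in> carrier_vec n"
    and pe: "\<And>u. eigenvector A u l \<Longrightarrow> \<exists>a. a \<noteq> 0 \<and> u = a \<cdot>\<^sub>v p"
    by (rule simple_eigenvalue_eigenspace_line[OF A simple]) (rule that)
  obtain q where q: "q \<in> carrier_vec n"
    and qe: "\<And>u. eigenvector (transpose_mat A) u l \<Longrightarrow> \<exists>a. a \<noteq> 0 \<and> u = a \<cdot>\<^sub>v q"
    by (rule simple_eigenvalue_eigenspace_line[OF AT simpleT]) (rule that)
  have val: "vec_norm2 u * vec_norm2 v / cmod (conjugate v \<bullet> u)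
      = vec_norm2 p * vec_norm2 q / cmod (q \<bullet> p)"
    if u: "eigenvector A u l" and v: "left_eigenvector A v l" for u v
  proof -
    obtain a where a: "a \<noteq> 0" "u = a \<cdot>\<^sub>v p"
      using pe[OF u] by blast
    obtain b where b: "b \<noteq> 0" "conjugate v = b \<cdot>\<^sub>v q"
      using qe v left_eigenvector_iff[OF A] by blast
    have nv: "vec_norm2 v = cmod b * vec_norm2 q"
      using arg_cong[OF b(2), of vec_norm2] by (simp add: vec_norm2_conjugate vec_norm2_smult)
    show ?thesis
      unfolding nv b(2) a(2) using a(1) b(1) p q by (simp add: vec_norm2_smult norm_mult)
  qed
  show ?thesis
    unfolding eigenvalue_cond_def using u v val by (intro the_equality) metis+
qed

section \<open>The perturbation bound\<close>

lemma relative_perturbation_le: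
  assumes S: "S \<in> carrier_mat (2 * n) (2 * n)"
    and X: "X \<in> carrier_mat (2 * n) k" and R: "R \<in> carrier_mat k k"
  shows "frob_norm (S + X * R * transpose_mat X * transpose_mat (J_mat n) * S - S) / frob_norm S
    \<le> (frob_norm X)\<^sup>2 * frob_norm R"
proof -
  let ?J = "transpose_mat (J_mat n)"
  let ?Y = "X * R * transpose_mat X"
  have J: "?J \<in> carrier_mat (2 * n) (2 * n)"
    using J_mat_carrier[of n] by simp
  have Y: "?Y \<in> carrier_mat (2 * n) (2 * n)"
    using X R by simp
  have assoc: "?Y * ?J * S = ?Y * (?J * S)"
    by (rule assoc_mult_mat[OF Y J S])
  have diff: "S + ?Y * ?J * S - S = ?Y * (?J * S)"
    unfolding assoc using S Y J by (intro eq_matI) auto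
  have "frob_norm (?Y * (?J * S)) \<le> frob_norm ?Y * frob_norm S"
    using frob_norm_mult_le[of ?Y "?J * S"] frob_norm_transpose_J_mat_mult[OF S] X J by simp
  also have "\<dots> \<le> (frob_norm X * frob_norm R * frob_norm X) * frob_norm S"
  proof (rule mult_right_mono[OF _ frob_norm_nonneg])
    have "frob_norm ?Y \<le> frob_norm (X * R) * frob_norm X"
      using frob_norm_mult_le[of "X * R" "transpose_mat X"] X R by (simp add: frob_norm_transpose)
    also have "\<dots> \<le> frob_norm X * frob_norm R * frob_norm X"
      using frob_norm_mult_le[of X R] X R by (intro mult_right_mono frob_norm_nonneg) simp
    finally show "frob_norm ?Y \<le> frob_norm X * frob_norm R * frob_norm X" .
  qed
  finally have le: "frob_norm (?Y * (?J * S)) \<le> (frob_norm X)\<^sup>2 * frob_norm R * frob_norm S"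
    by (simp add: power2_eq_square mult_ac)
  show ?thesis
  proof (cases "frob_norm S = 0")
    case True
    then show ?thesis by (simp add: frob_norm_nonneg)
  next
    case False
    then have "0 < frob_norm S"
      using frob_norm_nonneg[of S] by simp
    then show ?thesis
      unfolding diff using le by (simp add: divide_le_eq)
  qed
qed

text \<open>The antidiagonal entries of both matrices \<open>R\<close> have absolute values \<open>d / l\<close> and
  \<open>d / m\<close>, where \<open>l\<close> and \<open>m\<close> are the absolute values of the eigenvalue to be moved and of its
  new value, and \<open>d\<close> is the distance between the two.\<close>

lemma sqrt_sum_quotients:
  fixes d l m :: real
  assumes "0 \<le> d" and "0 < l"
  shows "sqrt ((d / l)\<^sup>2 + (d / m)\<^sup>2) = d / l * sqrt (1 + l\<^sup>2 / m\<^sup>2)"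
proof -
  have "(d / l)\<^sup>2 + (d / m)\<^sup>2 = (d / l)\<^sup>2 * (1 + l\<^sup>2 / m\<^sup>2)"
    using assms by (simp add: power_divide field_simps)
  then show ?thesis
    using assms by (simp add: real_sqrt_mult)
qed

theorem theorem5:
  fixes n :: nat and S X R1 R2 S1 S2 :: "complex mat" and x1 x2 :: "complex vec"
    and l1 \<mu> c s :: complex and \<Phi> :: real
  assumes "symplectic_mat n S"
    and "l1 \<in> spectrum S" and "inverse l1 \<in> spectrum S"
    and "\<mu> \<noteq> 0"
    and "eigenvector S x1 l1" and "eigenvector S x2 (inverse l1)"
    and "vec_norm2 x1 = 1" and "vec_norm2 x2 = 1"
  defines "c \<equiv> x1 \<bullet> (J_mat n *\<^sub>v x2)"
  assumes "c \<noteq> 0" and "s\<^sup>2 = c"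
  defines "X \<equiv> (1 / s) \<cdot>\<^sub>m mat_of_cols (2 * n) [x1, x2]"
    and "\<Phi> \<equiv> 2 / cmod c"
    and "R1 \<equiv> mat_of_rows_list 2 [[0, inverse l1 * (\<mu> - l1)],
                                   [inverse \<mu> * (\<mu> - l1), 0]]"
    and "R2 \<equiv> mat_of_rows_list 2 [[0, inverse \<mu> * (inverse l1 - \<mu>)],
                                   [l1 * (inverse l1 - \<mu>), 0]]"
    and "S1 \<equiv> S + X * R1 * transpose_mat X * transpose_mat (J_mat n) * S"
    and "S2 \<equiv> S + X * R2 * transpose_mat X * transpose_mat (J_mat n) * S"
  shows "(simple_eigenvalue S l1 \<longrightarrow> \<Phi> = 2 * eigenvalue_cond S l1) \<and>
    frob_norm (S1 - S) / frob_norm S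
      \<le> cmod (l1 - \<mu>) / cmod l1 * (\<Phi> * sqrt (1 + (cmod l1)\<^sup>2 / (cmod \<mu>)\<^sup>2)) \<and>
    frob_norm (S2 - S) / frob_norm S
      \<le> cmod (inverse l1 - \<mu>) / cmod (inverse l1)
          * (\<Phi> * sqrt (1 + (cmod (inverse l1))\<^sup>2 / (cmod \<mu>)\<^sup>2))"
proof -
  have S: "S \<in> carrier_mat (2 * n) (2 * n)"
    using \<open>symplectic_mat n S\<close> by (simp add: symplectic_mat_def)
  have x1: "x1 \<in> carrier_vec (2 * n)" and x2: "x2 \<in> carrier_vec (2 * n)"
    using \<open>eigenvector S x1 l1\<close> \<open>eigenvector S x2 (inverse l1)\<close> S by (auto simp: eigenvector_def)
  define w where "w = J_mat n *\<^sub>v x2"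
  have w: "w \<in> carrier_vec (2 * n)"
    using J_mat_carrier[of n] x2 by (simp add: w_def)
  have w0: "w \<noteq> 0\<^sub>v (2 * n)"
    using \<open>c \<noteq> 0\<close> x1 by (auto simp: c_def w_def[symmetric])
  have l1: "l1 \<noteq> 0"
    by (rule symplectic_eigenvalue_nonzero[OF \<open>symplectic_mat n S\<close> \<open>eigenvector S x1 l1\<close>])
  have cond: "\<Phi> = 2 * eigenvalue_cond S l1" if simple: "simple_eigenvalue S l1"
  proof -
    have "eigenvector (transpose_mat S) w l1"
      using symplectic_transpose_eigenvector[OF \<open>symplectic_mat n S\<close> l1
          \<open>eigenvector S x2 (inverse l1)\<close>] w w0 S
      by (simp add: eigenvector_def w_def)
    then have "left_eigenvector S (conjugate w) l1"
      by (simp add: left_eigenvector_iff[OF S])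
    from eigenvalue_cond_eqI[OF S simple \<open>eigenvector S x1 l1\<close> this]
    have "eigenvalue_cond S l1 = 1 / cmod (w \<bullet> x1)"
      using \<open>vec_norm2 x1 = 1\<close> \<open>vec_norm2 x2 = 1\<close> vec_norm2_J_mat_mult[OF x2]
      by (simp add: vec_norm2_conjugate w_def)
    also have "w \<bullet> x1 = c"
      using comm_scalar_prod[OF w x1] by (simp add: c_def w_def)
    finally show ?thesis
      by (simp add: \<Phi>_def)
  qed
  have X: "X \<in> carrier_mat (2 * n) 2"
    by (rule carrier_matI) (simp_all add: X_def)
  have "(cmod s)\<^sup>2 = cmod c"
    using \<open>s\<^sup>2 = c\<close> by (simp add: norm_power[symmetric])
  then have X_norm: "(frob_norm X)\<^sup>2 = \<Phi>"
    unfolding X_def \<Phi>_def frob_norm_two_cols_square[OF x1 x2]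
    using \<open>vec_norm2 x1 = 1\<close> \<open>vec_norm2 x2 = 1\<close> by (simp add: norm_divide power_divide)
  have R1: "R1 \<in> carrier_mat 2 2" and R2: "R2 \<in> carrier_mat 2 2"
    by (intro carrier_matI; simp add: R1_def R2_def mat_of_rows_list_def)+
  have "frob_norm R1 = sqrt ((cmod (l1 - \<mu>) / cmod l1)\<^sup>2 + (cmod (l1 - \<mu>) / cmod \<mu>)\<^sup>2)"
    unfolding R1_def frob_norm_antidiagonal
    by (simp add: norm_mult norm_inverse norm_minus_commute divide_inverse mult.commute)
  also have "\<dots> = cmod (l1 - \<mu>) / cmod l1 * sqrt (1 + (cmod l1)\<^sup>2 / (cmod \<mu>)\<^sup>2)"
    using l1 by (intro sqrt_sum_quotients) simp_all
  finally have R1_norm: "frob_norm R1 = \<dots>" .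
  have "frob_norm R2 = sqrt ((cmod (inverse l1 - \<mu>) / cmod (inverse l1))\<^sup>2
      + (cmod (inverse l1 - \<mu>) / cmod \<mu>)\<^sup>2)"
    unfolding R2_def frob_norm_antidiagonal
    by (simp add: norm_mult norm_inverse divide_inverse mult.commute add.commute)
  also have "\<dots> = cmod (inverse l1 - \<mu>) / cmod (inverse l1)
      * sqrt (1 + (cmod (inverse l1))\<^sup>2 / (cmod \<mu>)\<^sup>2)"
    using l1 by (intro sqrt_sum_quotients) simp_all
  finally have R2_norm: "frob_norm R2 = \<dots>" .
  have bound1: "frob_norm (S1 - S) / frob_norm S
      \<le> cmod (l1 - \<mu>) / cmod l1 * (\<Phi> * sqrt (1 + (cmod l1)\<^sup>2 / (cmod \<mu>)\<^sup>2))"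
    using relative_perturbation_le[OF S X R1]
    unfolding S1_def[symmetric] X_norm R1_norm by (simp only: mult_ac)
  have bound2: "frob_norm (S2 - S) / frob_norm S
      \<le> cmod (inverse l1 - \<mu>) / cmod (inverse l1)
          * (\<Phi> * sqrt (1 + (cmod (inverse l1))\<^sup>2 / (cmod \<mu>)\<^sup>2))"
    using relative_perturbation_le[OF S X R2]
    unfolding S2_def[symmetric] X_norm R2_norm by (simp only: mult_ac)
  show ?thesis
    using cond bound1 bound2 by blast
qed

end
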